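(* Let $q=q_u\,q_{-u\mid u}$ be any admissible importance sampling density for the input $\mathbf{X}$, and define $$Z_u:=\sqrt{w_u(\mathbf{X}_u)}\;w_{-u\mid u}(\mathbf{X}_{-u}\mid\mathbf{X}_u)\,Y .$$ Then $$\mathbb{E}_q[Z_u\mid\mathbf{X}_u]=\sqrt{w_u(\mathbf{X}_u)}\;m(\mathbf{X}_u)\qquad (q\text{-almost surely}).$$ In particular, $$\eta_u=\mathbb{E}_p\big[(\mathbb{E}_p[Y\mid\mathbf{X}_u])^2\big]=\mathbb{E}_q\big[(\mathbb{E}_q[Z_u\mid\mathbf{X}_u])^2\big]=\mathbb{E}_q\big[Z_u\,\mathbb{E}_q[Z_u\mid\mathbf{X}_u]\big].$$
   Context: Setting. $Y=f(\mathbf{X},\mathbf{W})$ is real-valued, where $f$ is measurable, $\mathbf{X}=(X_1,\dots,X_k)$ is a random vector in $\mathbb{R}^k$ and $\mathbf{W}$ is a random vector independent of $\mathbf{X}$ whose distribution is fixed. $\mathbb{E}_p$ (resp. $\mathbb{E}_q$) denotes expectation when $\mathbf{X}$ has Lebesgue density $p$ (resp. $q$) on $\mathbb{R}^k$, with $\mathbf{W}$ keeping the same distribution and being independent of $\mathbf{X}$ in both cases. The components of $\mathbf{X}$ may be dependent. $p$ is the reference density, and $\mathbb{E}_p[Y^2]<\infty$. Fix a nonempty $u\subseteq\{1,\dots,k\}$; $\mathbf{X}_u=(X_j)_{j\in u}$ and $\mathbf{X}_{-u}=(X_j)_{j\notin u}$. Densities are factorised as marginal times conditional, $p(\mathbf{x})=p_u(\mathbf{x}_u)\,p_{-u\mid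 u}(\mathbf{x}_{-u}\mid\mathbf{x}_u)$ and $q(\mathbf{x})=q_u(\mathbf{x}_u)\,q_{-u\mid u}(\mathbf{x}_{-u}\mid\mathbf{x}_u)$ (conditional factors are identically $1$ if $u=\{1,\dots,k\}$). Weights: $w_u(\mathbf{x}_u)=p_u(\mathbf{x}_u)/q_u(\mathbf{x}_u)$ and $w_{-u\mid u}(\mathbf{x}_{-u}\mid\mathbf{x}_u)=p_{-u\mid u}(\mathbf{x}_{-u}\mid\mathbf{x}_u)/q_{-u\mid u}(\mathbf{x}_{-u}\mid\mathbf{x}_u)$. Put $m(\mathbf{x}_u)=\mathbb{E}_p[Y\mid\mathbf{X}_u=\mathbf{x}_u]$, $\eta_u=\mathbb{E}_p[m^2(\mathbf{X}_u)]$ and $\phi(\mathbf{x})=\sqrt{\mathbb{E}[Y^2\mid\mathbf{X}=\mathbf{x}]}$ (which does not depend on the density of $\mathbf{X}$). Admissibility (support condition): (a) for almost every $\mathbf{x}_u$ with $p_u(\mathbf{x}_u)q_u(\mathbf{x}_u)>0$, one has $q_{-u\mid u}(\mathbf{x}_{-u}\mid\mathbf{x}_u)>0$ for almost every $\mathbf{x}_{-u}$ with $p_{-u\mid u}(\mathbf{x}_{-u}\mid\mathbf{x}_u)\phi(\mathbf{x})>0$; (b) $q_u(\mathbf{x}_u)>0$ for almost every $\mathbf{x}_u$ with $p_u(\mathbf{x}_u)\,m(\mathbf{x}_u)\neq0$. Conventions: where $p_u(\mathbf{x}_u)=0$, set $m(\mathbf{x}_u)=0$ and $Z_u=0$; $0\cdot\infty=0$.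 *)

theory Defs
  imports "HOL-Probability.Probability"
begin

text \<open>
  Vectors indexed by a finite set \<open>I\<close> of naturals are the extensional functions in
  \<open>space (leb I)\<close>. The subvector of \<open>x\<close> with coordinates in \<open>u\<close> is \<open>restrict x u\<close>, and
  \<open>merge u (I - u) (a, b)\<close> reassembles a vector from its two subvectors. The measure
  \<open>leb {}\<close> is the unit mass at the only vector of dimension zero.
\<close>

abbreviation leb :: "nat set \<Rightarrow> (nat \<Rightarrow> real) measure" where
  "leb I \<equiv> (\<Pi>\<^sub>M i\<in>I. lborel)"

definition input_model ::
  "'w measure \<Rightarrow> nat \<Rightarrow> nat \<Rightarrow> ('w \<Rightarrow> nat \<Rightarrow> real) \<Rightarrow> ('w \<Rightarrow> nat \<Rightarrow> real) \<Rightarrow> ((nat \<Rightarrow> real) \<Rightarrow> real) \<Rightarrow> bool"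
  where
  "input_model M k d X W p \<longleftrightarrow>
     prob_space M \<and>
     (\<forall>x\<in>space (leb {1..k}). 0 \<le> p x) \<and>
     distributed M (leb {1..k}) X (\<lambda>x. ennreal (p x)) \<and>
     prob_space.indep_var M (leb {1..k}) X (leb {1..d}) W"

text \<open>
  \<open>pu\<close> is a marginal density of the density \<open>p\<close> and \<open>pc a b\<close> a conditional density at \<open>b\<close>
  given \<open>a\<close>. These are only determined up to null sets, and \<open>pc a\<close> is unconstrained where
  \<open>pu a = 0\<close>; any choice is allowed. That \<open>pc a\<close> integrates to 1 for almost every \<open>a\<close> with
  \<open>pu a > 0\<close> follows from the marginal and product equations.
\<close>

definition density_factors ::
  "nat set \<Rightarrow> nat set \<Rightarrow> ((nat \<Rightarrow> real) \<Rightarrow> real) \<Rightarrow>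
   ((nat \<Rightarrow> real) \<Rightarrow> real) \<Rightarrow> ((nat \<Rightarrow> real) \<Rightarrow> (nat \<Rightarrow> real) \<Rightarrow> real) \<Rightarrow> bool"
  where
  "density_factors I u p pu pc \<longleftrightarrow>
     pu \<in> borel_measurable (leb u) \<and>
     (\<lambda>(a, b). pc a b) \<in> borel_measurable (leb u \<Otimes>\<^sub>M leb (I - u)) \<and>
     (\<forall>a\<in>space (leb u). 0 \<le> pu a) \<and>
     (\<forall>a\<in>space (leb u). \<forall>b\<in>space (leb (I - u)). 0 \<le> pc a b) \<and>
     (AE a in leb u. ennreal (pu a) = (\<integral>\<^sup>+ b. ennreal (p (merge u (I - u) (a, b))) \<partial>leb (I - u))) \<and>
     (AE x in leb I. p x = pu (restrict x u) * pc (restrict x u) (restrict x (I - u))) \<and>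
     (u = I \<longrightarrow> (\<forall>a\<in>space (leb u). \<forall>b\<in>space (leb (I - u)). pc a b = 1))"

definition cond_expect ::
  "'w measure \<Rightarrow> 'v measure \<Rightarrow> ('w \<Rightarrow> 'v) \<Rightarrow> ('w \<Rightarrow> real) \<Rightarrow> 'w \<Rightarrow> real"
  where
  "cond_expect M N V Y = real_cond_exp M (vimage_algebra (space M) V N) Y"

text \<open>\<open>g\<close> is a version of the function \<open>v \<mapsto> E[Y | V = v]\<close>.\<close>

definition cond_expect_fun ::
  "'w measure \<Rightarrow> 'v measure \<Rightarrow> ('w \<Rightarrow> 'v) \<Rightarrow> ('w \<Rightarrow> real) \<Rightarrow> ('v \<Rightarrow> real) \<Rightarrow> bool"
  where
  "cond_expect_fun M N V Y g \<longleftrightarrow>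
     g \<in> borel_measurable N \<and> (AE \<omega> in M. g (V \<omega>) = cond_expect M N V Y \<omega>)"

definition admissible ::
  "nat set \<Rightarrow> nat set \<Rightarrow>
   ((nat \<Rightarrow> real) \<Rightarrow> real) \<Rightarrow> ((nat \<Rightarrow> real) \<Rightarrow> (nat \<Rightarrow> real) \<Rightarrow> real) \<Rightarrow>
   ((nat \<Rightarrow> real) \<Rightarrow> real) \<Rightarrow> ((nat \<Rightarrow> real) \<Rightarrow> (nat \<Rightarrow> real) \<Rightarrow> real) \<Rightarrow>
   ((nat \<Rightarrow> real) \<Rightarrow> real) \<Rightarrow> ((nat \<Rightarrow> real) \<Rightarrow> real) \<Rightarrow> bool"
  where
  "admissible I u pu pc qu qc m \<phi> \<longleftrightarrow>
     (AE a in leb u. pu a * qu a > 0 \<longrightarrow>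
        (AE b in leb (I - u). pc a b * \<phi> (merge u (I - u) (a, b)) > 0 \<longrightarrow> qc a b > 0)) \<and>
     (AE a in leb u. pu a * m a \<noteq> 0 \<longrightarrow> qu a > 0)"

text \<open>
  The weighted output, with \<open>V\<close> and \<open>V'\<close> the subvectors of the input inside and outside \<open>u\<close>.
  It vanishes where \<open>pu (V \<omega>) = 0\<close>, as intended. Division by zero (with value 0) only occurs
  on a null event of the law with density \<open>q\<close>.
\<close>

definition weighted_output ::
  "('a \<Rightarrow> real) \<Rightarrow> ('a \<Rightarrow> 'b \<Rightarrow> real) \<Rightarrow> ('a \<Rightarrow> real) \<Rightarrow> ('a \<Rightarrow> 'b \<Rightarrow> real) \<Rightarrow>
   ('w \<Rightarrow> 'a) \<Rightarrow> ('w \<Rightarrow> 'b) \<Rightarrow> ('w \<Rightarrow> real) \<Rightarrow> 'w \<Rightarrow> real"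
  where
  "weighted_output pu pc qu qc V V' Y \<omega> =
     sqrt (pu (V \<omega>) / qu (V \<omega>)) * (pc (V \<omega>) (V' \<omega>) / qc (V \<omega>) (V' \<omega>)) * Y \<omega>"

end

theory Submission
  imports Defs
begin

text \<open>
  The proof compares integrals under \<open>P\<close> and \<open>Q\<close> by a change of measure. In either model the
  independent pair \<open>(X, W)\<close> has, with respect to the same measure, namely Lebesgue measure
  times the law of \<open>W\<close>, the density \<open>p x\<close> or \<open>q x\<close> (\<open>input_model_joint_density\<close>). The
  conditional factors cancel,
  \<open>qu * qc * (pc / qc) = qu * pc = p * (qu / pu)\<close>, so the conditional weight replaces the
  conditional density of \<open>q\<close> by that of \<open>p\<close>, and for every function \<open>c\<close> of \<open>Xu\<close> that
  vanishes with \<open>pu\<close>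
  \[ E_Q [c(X_u) (pc/qc) Y] = E_P [c(X_u) (qu/pu) Y], \qquad
     E_Q [c(X_u)] = E_P [c(X_u) (qu/pu)]. \]
  These are \<open>weighted_output_change_of_measure\<close> and \<open>marginal_change_of_measure\<close>.

  The cancellation needs \<open>qc > 0\<close>. Admissibility gives this only where \<open>E[Y^2 | X = x] > 0\<close>;
  at the other points with \<open>p x > 0\<close> the output itself is almost surely zero
  (\<open>zero_where_cond_expect_square_nonpos\<close>), so both integrands vanish. Where \<open>qu = 0\<close> both
  integrands vanish as well.

  Let \<open>v = sqrt (pu / qu)\<close> and \<open>r = qu / pu\<close>. The conditional expectation of \<open>Z\<close> is identified
  by integrating over \<open>Xu \<in> B\<close>: the integral of \<open>Z\<close> becomes that of \<open>v * r * Y\<close> under \<open>P\<close>, where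
  \<open>Y\<close> may be replaced by \<open>m\<close> since \<open>v * r\<close> is a function of \<open>Xu\<close>, and the second change of
  measure leads back to the integral of \<open>v * m\<close> under \<open>Q\<close>. For the second moments,
  \<open>v^2 * r = 1\<close> where \<open>pu\<close> and \<open>qu\<close> are positive, and the second admissibility condition
  says that \<open>m\<close> vanishes almost everywhere where \<open>pu > 0\<close> and \<open>qu = 0\<close>; hence \<open>E_Q [(v * m)^2]\<close> and \<open>E_Q [Z * v * m]\<close> become
  \<open>E_P [m^2]\<close> and \<open>E_P [m * Y]\<close>, which agree. Integrability of \<open>Z\<close> comes from
  \<open>(v * r)^2 \<le> r\<close> and \<open>E_P [r(Xu)] \<le> 1\<close> together with \<open>E_P [Y^2] < \<infinity>\<close>.
\<close>

section \<open>Densities of the input and of its subvectors\<close>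

lemma input_modelD:
  assumes "input_model M k d X W p"
  shows "prob_space M" and "X \<in> M \<rightarrow>\<^sub>M leb {1..k}" and "W \<in> M \<rightarrow>\<^sub>M leb {1..d}"
    and "p \<in> borel_measurable (leb {1..k})" and "x \<in> space (leb {1..k}) \<Longrightarrow> 0 \<le> p x"
proof -
  have D: "distributed M (leb {1..k}) X (\<lambda>x. ennreal (p x))"
    and "prob_space M" and ind: "prob_space.indep_var M (leb {1..k}) X (leb {1..d}) W"
    and nn: "\<And>x. x \<in> space (leb {1..k}) \<Longrightarrow> 0 \<le> p x"
    using assms unfolding input_model_def by auto
  then interpret prob_space M by simp
  show "prob_space M" by fact
  show "X \<in> M \<rightarrow>\<^sub>M leb {1..k}" "W \<in> M \<rightarrow>\<^sub>M leb {1..d}"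
    using ind indep_var_rv1 indep_var_rv2 by blast+
  show "p \<in> borel_measurable (leb {1..k})"
    using distributed_real_measurable[OF _ D] nn by blast
  show "x \<in> space (leb {1..k}) \<Longrightarrow> 0 \<le> p x" using nn .
qed

lemma input_model_joint_density:
  assumes "input_model M k d X W p"
  shows "distributed M (leb {1..k} \<Otimes>\<^sub>M distr M (leb {1..d}) W) (\<lambda>\<omega>. (X \<omega>, W \<omega>))
           (\<lambda>z. ennreal (p (fst z)))"
proof -
  note [measurable] = input_modelD(2-4)[OF assms]
  interpret prob_space M by (rule input_modelD(1)[OF assms])
  let ?N = "distr M (leb {1..d}) W"
  interpret N: prob_space ?N by (rule prob_space_distr) measurable
  have sf: "sigma_finite_measure ?N"
    by (rule N.sigma_finite_measure_axioms)
  have D: "distr M (leb {1..k}) X = density (leb {1..k}) (\<lambda>x. ennreal (p x))"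
    and ind: "indep_var (leb {1..k}) X (leb {1..d}) W"
    using assms unfolding input_model_def distributed_def by auto
  have "distr M (leb {1..k} \<Otimes>\<^sub>M ?N) (\<lambda>\<omega>. (X \<omega>, W \<omega>))
      = distr M (leb {1..k} \<Otimes>\<^sub>M leb {1..d}) (\<lambda>\<omega>. (X \<omega>, W \<omega>))"
    by (intro distr_cong sets_pair_measure_cong) auto
  also have "\<dots> = distr M (leb {1..k}) X \<Otimes>\<^sub>M ?N"
    using ind unfolding indep_var_distribution_eq by simp
  also have "\<dots> = density (leb {1..k}) (\<lambda>x. ennreal (p x)) \<Otimes>\<^sub>M density ?N (\<lambda>_. 1)"
    unfolding D density_1 ..
  also have "\<dots> = density (leb {1..k} \<Otimes>\<^sub>M ?N) (\<lambda>(x, y). ennreal (p x) * 1)"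
    by (rule pair_measure_density) (unfold density_1, measurable, fact+)
  finally have "distr M (leb {1..k} \<Otimes>\<^sub>M ?N) (\<lambda>\<omega>. (X \<omega>, W \<omega>))
      = density (leb {1..k} \<Otimes>\<^sub>M ?N) (\<lambda>z. ennreal (p (fst z)))"
    by (simp only: case_prod_beta' mult_1_right)
  then show ?thesis
    unfolding distributed_def by (intro conjI) measurable
qed

text \<open>
  Fubini: integrating the density of \<open>X\<close> over the remaining coordinates gives \<open>pu\<close> almost
  everywhere, by the marginal equation in \<open>density_factors\<close>.
\<close>

lemma distributed_restrict:
  assumes fin: "finite I" and u: "u \<subseteq> I"
    and X: "distributed M (leb I) X (\<lambda>x. ennreal (p x))"
    and pu: "density_factors I u p pu pc"
  shows "distributed M (leb u) (\<lambda>\<omega>. restrict (X \<omega>) u) (\<lambda>a. ennreal (pu a))"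
proof -
  interpret product_sigma_finite "\<lambda>_::nat. lborel :: real measure"
    by standard
  have Un: "u \<union> (I - u) = I" using u by auto
  have [measurable]: "X \<in> M \<rightarrow>\<^sub>M leb I" "pu \<in> borel_measurable (leb u)"
    "(\<lambda>x. ennreal (p x)) \<in> borel_measurable (leb I)"
    using X pu unfolding distributed_def density_factors_def by auto
  have [measurable]: "(\<lambda>x. restrict x u) \<in> leb I \<rightarrow>\<^sub>M leb u"
    by (rule measurable_restrict_subset[OF u])
  have mrg[measurable]: "merge u (I - u) \<in> leb u \<Otimes>\<^sub>M leb (I - u) \<rightarrow>\<^sub>M leb I"
    using measurable_merge[of u "I - u" "\<lambda>_. lborel"] unfolding Un .
  have "distr M (leb u) (\<lambda>\<omega>. restrict (X \<omega>) u) = density (leb u) (\<lambda>a. ennreal (pu a))"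
  proof (rule measure_eqI)
    fix A assume "A \<in> sets (distr M (leb u) (\<lambda>\<omega>. restrict (X \<omega>) u))"
    then have [measurable]: "A \<in> sets (leb u)" by simp
    have "emeasure (distr M (leb u) (\<lambda>\<omega>. restrict (X \<omega>) u)) A
        = (\<integral>\<^sup>+ a. indicator A a \<partial>distr M (leb u) (\<lambda>\<omega>. restrict (X \<omega>) u))"
      by simp
    also have "\<dots> = (\<integral>\<^sup>+ \<omega>. indicator A (restrict (X \<omega>) u) \<partial>M)"
      by (subst nn_integral_distr) auto
    also have "\<dots> = (\<integral>\<^sup>+ x. ennreal (p x) * indicator A (restrict x u) \<partial>leb I)"
      by (rule distributed_nn_integral[OF X, symmetric]) measurable
    also have "\<dots> = (\<integral>\<^sup>+ a. (\<integral>\<^sup>+ b. ennreal (p (merge u (I - u) (a, b))) *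
        indicator A (restrict (merge u (I - u) (a, b)) u) \<partial>leb (I - u)) \<partial>leb u)"
      using product_nn_integral_fold[of u "I - u" "\<lambda>x. ennreal (p x) * indicator A (restrict x u)"]
        fin u finite_subset[OF u fin] unfolding Un by simp
    also have "\<dots> = (\<integral>\<^sup>+ a. ennreal (pu a) * indicator A a \<partial>leb u)"
    proof (rule nn_integral_cong_AE)
      have "AE a in leb u. ennreal (pu a) = (\<integral>\<^sup>+ b. ennreal (p (merge u (I - u) (a, b))) \<partial>leb (I - u))"
        using pu unfolding density_factors_def by blast
      then show "AE a in leb u. (\<integral>\<^sup>+ b. ennreal (p (merge u (I - u) (a, b))) *
          indicator A (restrict (merge u (I - u) (a, b)) u) \<partial>leb (I - u))
        = ennreal (pu a) * indicator A a"
        using AE_space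
      proof eventually_elim
        case (elim a)
        have [simp]: "restrict a u = a"
          using elim(2) by (simp add: space_PiM extensional_restrict PiE_iff)
        have "(\<lambda>b. merge u (I - u) (a, b)) \<in> leb (I - u) \<rightarrow>\<^sub>M leb I"
          using measurable_Pair1'[OF elim(2), of "leb (I - u)"] mrg by (rule measurable_compose)
        then have [measurable]:
          "(\<lambda>b. ennreal (p (merge u (I - u) (a, b)))) \<in> borel_measurable (leb (I - u))"
          by measurable
        show ?case
          by (simp add: nn_integral_multc elim(1))
      qed
    qed
    also have "\<dots> = emeasure (density (leb u) (\<lambda>a. ennreal (pu a))) A"
      by (subst emeasure_density) auto
    finally show "emeasure (distr M (leb u) (\<lambda>\<omega>. restrict (X \<omega>) u)) A
      = emeasure (density (leb u) (\<lambda>a. ennreal (pu a))) A" .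
  qed simp
  then show ?thesis
    unfolding distributed_def by auto
qed

text \<open>
  \<open>admissible\<close> speaks of almost every \<open>a\<close> and then almost every \<open>b\<close>, whereas densities are
  compared at almost every full vector. Measurability of \<open>R\<close> makes the iterated form imply the
  joint one.
\<close>

lemma AE_leb_merge:
  assumes fin: "finite I" and u: "u \<subseteq> I"
    and meas: "Measurable.pred (leb I) R"
    and ae: "AE a in leb u. AE b in leb (I - u). R (merge u (I - u) (a, b))"
  shows "AE x in leb I. R x"
proof -
  interpret product_sigma_finite "\<lambda>_::nat. lborel :: real measure"
    by standard
  interpret U: finite_product_sigma_finite "\<lambda>_::nat. lborel :: real measure" u
    by standard (rule finite_subset[OF u fin])
  interpret V: finite_product_sigma_finite "\<lambda>_::nat. lborel :: real measure" "I - u"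
    by standard (use fin in auto)
  interpret UV: pair_sigma_finite "leb u" "leb (I - u)" ..
  have Un: "u \<union> (I - u) = I" using u by auto
  note [measurable] = meas
  have mrg[measurable]: "merge u (I - u) \<in> leb u \<Otimes>\<^sub>M leb (I - u) \<rightarrow>\<^sub>M leb I"
    using measurable_merge[of u "I - u" "\<lambda>_. lborel"] unfolding Un .
  have "AE z in leb u \<Otimes>\<^sub>M leb (I - u). R (merge u (I - u) z)"
    using ae by (intro UV.AE_pair_measure) auto
  then have "AE x in distr (leb u \<Otimes>\<^sub>M leb (I - u)) (leb I) (merge u (I - u)). R x"
    by (subst AE_distr_iff) auto
  moreover have "distr (leb u \<Otimes>\<^sub>M leb (I - u)) (leb I) (merge u (I - u)) = leb I"
    using distr_merge[of u "I - u"] fin finite_subset[OF u fin] unfolding Un by simp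
  ultimately show ?thesis by (simp only:)
qed

lemma distributed_AE:
  assumes "distributed M N X (\<lambda>x. ennreal (f x))" and "Measurable.pred N R"
  shows "(AE \<omega> in M. R (X \<omega>)) \<longleftrightarrow> (AE x in N. 0 < f x \<longrightarrow> R x)"
proof -
  have X: "X \<in> M \<rightarrow>\<^sub>M N" and f: "(\<lambda>x. ennreal (f x)) \<in> borel_measurable N"
    and D: "distr M N X = density N (\<lambda>x. ennreal (f x))"
    using assms(1) unfolding distributed_def by auto
  have "(AE \<omega> in M. R (X \<omega>)) \<longleftrightarrow> (AE x in distr M N X. R x)"
    using AE_distr_iff[OF X] assms(2) unfolding pred_def by simp
  also have "\<dots> \<longleftrightarrow> (AE x in N. 0 < f x \<longrightarrow> R x)"
    unfolding D AE_density[OF f] by simp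
  finally show ?thesis .
qed

text \<open>
  Both random variables have densities with respect to the same \<open>N\<close>, so equality of two
  expectations reduces to a pointwise identity of integrands, and integrability carries over
  along with it. Both changes of measure below are instances.
\<close>

lemma distributed_change_of_measure:
  fixes p q g h :: "'b \<Rightarrow> real"
  assumes S: "distributed P N S (\<lambda>x. ennreal (p x))" and T: "distributed Q N T (\<lambda>x. ennreal (q x))"
    and nn: "\<And>x. x \<in> space N \<Longrightarrow> 0 \<le> p x" "\<And>x. x \<in> space N \<Longrightarrow> 0 \<le> q x"
    and g: "g \<in> borel_measurable N" and h: "h \<in> borel_measurable N"
    and eq: "AE x in N. q x * g x = p x * h x"
  shows "integrable Q (\<lambda>\<omega>. g (T \<omega>)) \<longleftrightarrow> integrable P (\<lambda>\<omega>. h (S \<omega>))"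
    and "(\<integral>\<omega>. g (T \<omega>) \<partial>Q) = (\<integral>\<omega>. h (S \<omega>) \<partial>P)"
proof -
  have [measurable]: "p \<in> borel_measurable N" "q \<in> borel_measurable N"
    using distributed_real_measurable[OF nn(1) S] distributed_real_measurable[OF nn(2) T] by auto
  note [measurable] = g h
  have "integrable N (\<lambda>x. q x * g x) \<longleftrightarrow> integrable N (\<lambda>x. p x * h x)"
    by (rule integrable_cong_AE[OF _ _ eq]) measurable
  then show "integrable Q (\<lambda>\<omega>. g (T \<omega>)) \<longleftrightarrow> integrable P (\<lambda>\<omega>. h (S \<omega>))"
    using distributed_integrable[OF S h nn(1)] distributed_integrable[OF T g nn(2)] by simp
  have "(\<integral>x. q x * g x \<partial>N) = (\<integral>x. p x * h x \<partial>N)"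
    by (rule integral_cong_AE[OF _ _ eq]) measurable
  then show "(\<integral>\<omega>. g (T \<omega>) \<partial>Q) = (\<integral>\<omega>. h (S \<omega>) \<partial>P)"
    using distributed_integral[OF S h nn(1)] distributed_integral[OF T g nn(2)] by simp
qed

section \<open>Conditional expectation given a random variable\<close>

lemma finite_measure_subalgebra_vimage:
  assumes "prob_space M" and V: "V \<in> M \<rightarrow>\<^sub>M N"
  shows "finite_measure_subalgebra M (vimage_algebra (space M) V N)"
proof -
  interpret prob_space M by fact
  show ?thesis
    by unfold_locales (simp add: subalgebra_def sets_image_in_sets[OF refl V])
qed

lemma measurable_vimage_compose:
  assumes V: "V \<in> M \<rightarrow>\<^sub>M N" and g: "g \<in> N \<rightarrow>\<^sub>M L"
  shows "(\<lambda>\<omega>. g (V \<omega>)) \<in> vimage_algebra (space M) V N \<rightarrow>\<^sub>M L"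
  using measurable_space[OF V] by (intro measurable_compose[OF measurable_vimage_algebra1 g]) auto

lemma cond_expect_fun_pull_out:
  assumes "prob_space M" and V: "V \<in> M \<rightarrow>\<^sub>M N" and Y: "Y \<in> borel_measurable M"
    and m: "cond_expect_fun M N V Y m" and h: "h \<in> borel_measurable N"
    and int: "integrable M (\<lambda>\<omega>. h (V \<omega>) * Y \<omega>)"
  shows "integrable M (\<lambda>\<omega>. h (V \<omega>) * m (V \<omega>))"
    and "(\<integral>\<omega>. h (V \<omega>) * m (V \<omega>) \<partial>M) = (\<integral>\<omega>. h (V \<omega>) * Y \<omega> \<partial>M)"
proof -
  interpret finite_measure_subalgebra M "vimage_algebra (space M) V N"
    by (rule finite_measure_subalgebra_vimage) fact+
  have [measurable]: "m \<in> borel_measurable N"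
    and ae: "AE \<omega> in M. m (V \<omega>) = cond_expect M N V Y \<omega>"
    using m unfolding cond_expect_fun_def by auto
  note [measurable] = V h
  have hV: "(\<lambda>\<omega>. h (V \<omega>)) \<in> borel_measurable (vimage_algebra (space M) V N)"
    by (rule measurable_vimage_compose[OF V h])
  have eq: "AE \<omega> in M. h (V \<omega>) * m (V \<omega>) = h (V \<omega>) * cond_expect M N V Y \<omega>"
    using ae by eventually_elim simp
  have [measurable]: "cond_expect M N V Y \<in> borel_measurable M"
    unfolding cond_expect_def by simp
  note intg = real_cond_exp_intg[OF int hV Y, folded cond_expect_def]
  show "integrable M (\<lambda>\<omega>. h (V \<omega>) * m (V \<omega>))"
    using intg(1) integrable_cong_AE[OF _ _ eq] by simp
  show "(\<integral>\<omega>. h (V \<omega>) * m (V \<omega>) \<partial>M) = (\<integral>\<omega>. h (V \<omega>) * Y \<omega> \<partial>M)"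
    using intg(2) integral_cong_AE[OF _ _ eq] by simp
qed

text \<open>
  Every event of the \<open>\<sigma>\<close>-algebra generated by \<open>V\<close> is of the form \<open>V \<in> B\<close>, so the defining
  integrals of the conditional expectation need only be tested on such events.
\<close>

lemma cond_expect_eqI:
  assumes "prob_space M" and V: "V \<in> M \<rightarrow>\<^sub>M N" and g: "g \<in> borel_measurable N"
    and intY: "integrable M Y" and intg: "integrable M (\<lambda>\<omega>. g (V \<omega>))"
    and eq: "\<And>B. B \<in> sets N \<Longrightarrow>
      (\<integral>\<omega>. indicator B (V \<omega>) * Y \<omega> \<partial>M) = (\<integral>\<omega>. indicator B (V \<omega>) * g (V \<omega>) \<partial>M)"
  shows "AE \<omega> in M. cond_expect M N V Y \<omega> = g (V \<omega>)"
proof -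
  interpret finite_measure_subalgebra M "vimage_algebra (space M) V N"
    by (rule finite_measure_subalgebra_vimage) fact+
  show ?thesis unfolding cond_expect_def
  proof (rule real_cond_exp_charact)
    fix A assume "A \<in> sets (vimage_algebra (space M) V N)"
    then obtain B where B: "B \<in> sets N" and A: "A = V -` B \<inter> space M"
      using measurable_space[OF V] by (auto simp: sets_vimage_algebra2 Pi_iff)
    have ind: "(\<integral>\<omega>\<in>A. f \<omega> \<partial>M) = (\<integral>\<omega>. indicator B (V \<omega>) * f \<omega> \<partial>M)" for f :: "_ \<Rightarrow> real"
      unfolding set_lebesgue_integral_def
      by (rule Bochner_Integration.integral_cong) (auto simp: A indicator_def)
    show "(\<integral>\<omega>\<in>A. Y \<omega> \<partial>M) = (\<integral>\<omega>\<in>A. g (V \<omega>) \<partial>M)"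
      unfolding ind by (rule eq[OF B])
  qed (use intY intg measurable_vimage_compose[OF V g] in auto)
qed

text \<open>Jensen's inequality for the square makes \<open>m(V)\<close> square integrable.\<close>

lemma cond_expect_fun_square_integrable:
  assumes "prob_space M" and V: "V \<in> M \<rightarrow>\<^sub>M N" and Y: "Y \<in> borel_measurable M"
    and m: "cond_expect_fun M N V Y m" and sq: "integrable M (\<lambda>\<omega>. (Y \<omega>)\<^sup>2)"
  shows "integrable M (\<lambda>\<omega>. (m (V \<omega>))\<^sup>2)"
    and "integrable M (\<lambda>\<omega>. (cond_expect M N V Y \<omega>)\<^sup>2)"
    and "(\<integral>\<omega>. (m (V \<omega>))\<^sup>2 \<partial>M) = (\<integral>\<omega>. (cond_expect M N V Y \<omega>)\<^sup>2 \<partial>M)"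
proof -
  interpret prob_space M by fact
  interpret finite_measure_subalgebra M "vimage_algebra (space M) V N"
    by (rule finite_measure_subalgebra_vimage) fact+
  have [measurable]: "m \<in> borel_measurable N"
    and ae: "AE \<omega> in M. m (V \<omega>) = cond_expect M N V Y \<omega>"
    using m unfolding cond_expect_fun_def by auto
  have [measurable]: "cond_expect M N V Y \<in> borel_measurable M"
    unfolding cond_expect_def by simp
  note [measurable] = V
  have eq: "AE \<omega> in M. (m (V \<omega>))\<^sup>2 = (cond_expect M N V Y \<omega>)\<^sup>2"
    using ae by eventually_elim simp
  have intY: "integrable M Y"
    by (rule square_integrable_imp_integrable[OF Y sq])
  show int: "integrable M (\<lambda>\<omega>. (cond_expect M N V Y \<omega>)\<^sup>2)"
    unfolding cond_expect_def
    by (rule integrable_convex_cond_exp[where I = UNIV and q = power2])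
      (use intY sq convex_power2 emeasure_space_1 in auto)
  show "integrable M (\<lambda>\<omega>. (m (V \<omega>))\<^sup>2)"
    using int integrable_cong_AE[OF _ _ eq] by simp
  show "(\<integral>\<omega>. (m (V \<omega>))\<^sup>2 \<partial>M) = (\<integral>\<omega>. (cond_expect M N V Y \<omega>)\<^sup>2 \<partial>M)"
    by (rule integral_cong_AE[OF _ _ eq]) measurable
qed

text \<open>
  Over the event \<open>s(V) \<le> 0\<close> the integral of \<open>Y^2\<close> equals that of \<open>s(V)\<close>, so it is zero. The
  conclusion is only almost sure because \<open>s\<close> is determined only up to null sets of the law of \<open>V\<close>;
  for the same reason \<open>s\<close> may take negative values, and the condition is an inequality.
\<close>

lemma zero_where_cond_expect_square_nonpos:
  assumes "prob_space M" and V: "V \<in> M \<rightarrow>\<^sub>M N" and Y: "Y \<in> borel_measurable M"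
    and sq: "integrable M (\<lambda>\<omega>. (Y \<omega>)\<^sup>2)" and s: "cond_expect_fun M N V (\<lambda>\<omega>. (Y \<omega>)\<^sup>2) s"
  shows "AE \<omega> in M. s (V \<omega>) \<le> 0 \<longrightarrow> Y \<omega> = 0"
proof -
  note [measurable] = V Y
  have [measurable]: "s \<in> borel_measurable N"
    using s unfolding cond_expect_fun_def by auto
  let ?h = "\<lambda>v. indicator {v. s v \<le> 0} v :: real"
  have int: "integrable M (\<lambda>\<omega>. ?h (V \<omega>) * (Y \<omega>)\<^sup>2)"
    by (rule Bochner_Integration.integrable_bound[OF sq]) (auto split: split_indicator)
  have "(\<integral>\<omega>. ?h (V \<omega>) * (Y \<omega>)\<^sup>2 \<partial>M) = (\<integral>\<omega>. ?h (V \<omega>) * s (V \<omega>) \<partial>M)"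
    by (rule cond_expect_fun_pull_out(2)[OF assms(1) V _ s _ int, symmetric]) measurable
  also have "\<dots> \<le> 0"
    using Bochner_Integration.integral_nonneg[of M "\<lambda>\<omega>. - (?h (V \<omega>) * s (V \<omega>))"]
    by (simp split: split_indicator)
  finally have "(\<integral>\<omega>. ?h (V \<omega>) * (Y \<omega>)\<^sup>2 \<partial>M) = 0"
    by (intro antisym Bochner_Integration.integral_nonneg) auto
  then have "AE \<omega> in M. ?h (V \<omega>) * (Y \<omega>)\<^sup>2 = 0"
    using integral_nonneg_eq_0_iff_AE[OF int] by auto
  then show ?thesis
    by eventually_elim (auto split: split_indicator_asm)
qed

section \<open>Change of measure between the two densities\<close>

lemma admissible_AE_support:
  assumes fin: "finite I" and u: "u \<subseteq> I"
    and P: "density_factors I u p pu pc" and Q: "density_factors I u q qu qc"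
    and s[measurable]: "s \<in> borel_measurable (leb I)"
    and adm: "admissible I u pu pc qu qc m (\<lambda>x. sqrt (s x))"
  shows "AE x in leb I. pu (restrict x u) * qu (restrict x u) > 0 \<longrightarrow>
    pc (restrict x u) (restrict x (I - u)) * sqrt (s x) > 0 \<longrightarrow>
    qc (restrict x u) (restrict x (I - u)) > 0"
proof (rule AE_leb_merge[OF fin u])
  have [measurable]: "pu \<in> borel_measurable (leb u)" "qu \<in> borel_measurable (leb u)"
    "(\<lambda>(a, b). pc a b) \<in> borel_measurable (leb u \<Otimes>\<^sub>M leb (I - u))"
    "(\<lambda>(a, b). qc a b) \<in> borel_measurable (leb u \<Otimes>\<^sub>M leb (I - u))"
    using P Q unfolding density_factors_def by auto
  have [measurable]: "(\<lambda>x. restrict x u) \<in> leb I \<rightarrow>\<^sub>M leb u"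
    "(\<lambda>x. restrict x (I - u)) \<in> leb I \<rightarrow>\<^sub>M leb (I - u)"
    by (intro measurable_restrict_subset; use u in blast)+
  show "Measurable.pred (leb I) (\<lambda>x. pu (restrict x u) * qu (restrict x u) > 0 \<longrightarrow>
    pc (restrict x u) (restrict x (I - u)) * sqrt (s x) > 0 \<longrightarrow>
    qc (restrict x u) (restrict x (I - u)) > 0)"
    by measurable
  have "AE a in leb u. pu a * qu a > 0 \<longrightarrow>
        (AE b in leb (I - u). pc a b * sqrt (s (merge u (I - u) (a, b))) > 0 \<longrightarrow> qc a b > 0)"
    using adm unfolding admissible_def by blast
  then show "AE a in leb u. AE b in leb (I - u).
    pu (restrict (merge u (I - u) (a, b)) u) * qu (restrict (merge u (I - u) (a, b)) u) > 0 \<longrightarrow>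
    pc (restrict (merge u (I - u) (a, b)) u) (restrict (merge u (I - u) (a, b)) (I - u)) *
      sqrt (s (merge u (I - u) (a, b))) > 0 \<longrightarrow>
    qc (restrict (merge u (I - u) (a, b)) u) (restrict (merge u (I - u) (a, b)) (I - u)) > 0"
    using AE_space
  proof eventually_elim
    case (elim a)
    have a[simp]: "restrict a u = a"
      using elim(2) by (simp add: space_PiM extensional_restrict PiE_iff)
    show ?case
    proof (cases "pu a * qu a > 0")
      case True
      have "AE b in leb (I - u). pc a b * sqrt (s (merge u (I - u) (a, b))) > 0 \<longrightarrow> qc a b > 0"
        using elim(1) True by blast
      then show ?thesis
        using AE_space
      proof eventually_elim
        case (elim b)
        have "restrict b (I - u) = b"
          using elim(2) by (simp add: space_PiM extensional_restrict PiE_iff)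
        then show ?case using elim(1) by simp
      qed
    qed simp
  qed
qed

text \<open>
  Where \<open>qu\<close> and \<open>pc\<close> are positive and \<open>s x > 0\<close>, admissibility gives \<open>qc > 0\<close> and the identity
  is \<open>qu * qc * (pc / qc) = pu * pc * (qu / pu)\<close>. Where \<open>qu\<close> or \<open>pc\<close> is zero, both sides are.
  The disjunct \<open>p x = 0\<close> belongs to the second kind, since it forces \<open>pc = 0\<close>; the points left out,
  with \<open>p x > 0\<close> and \<open>s x \<le> 0\<close>, are those where the output vanishes.
\<close>

lemma conditional_weight_cancels:
  assumes fin: "finite I" and u: "u \<subseteq> I"
    and P: "density_factors I u p pu pc" and Q: "density_factors I u q qu qc"
    and s: "s \<in> borel_measurable (leb I)"
    and adm: "admissible I u pu pc qu qc m (\<lambda>x. sqrt (s x))"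
  shows "AE x in leb I. pu (restrict x u) \<noteq> 0 \<longrightarrow> p x = 0 \<or> s x > 0 \<longrightarrow>
    q x * (pc (restrict x u) (restrict x (I - u)) / qc (restrict x u) (restrict x (I - u)))
    = p x * (qu (restrict x u) / pu (restrict x u))"
proof -
  have fp: "AE x in leb I. p x = pu (restrict x u) * pc (restrict x u) (restrict x (I - u))"
    and fq: "AE x in leb I. q x = qu (restrict x u) * qc (restrict x u) (restrict x (I - u))"
    using P Q unfolding density_factors_def by blast+
  show ?thesis
    using fp fq admissible_AE_support[OF assms] AE_space
  proof eventually_elim
    case (elim x)
    define a b where "a = restrict x u" and "b = restrict x (I - u)"
    have "a \<in> space (leb u)" "b \<in> space (leb (I - u))"
      using elim(4) u by (auto simp: a_def b_def space_PiM)
    then have nn: "0 \<le> pu a" "0 \<le> qu a" "0 \<le> pc a b" "0 \<le> qc a b"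
      using P Q unfolding density_factors_def by auto
    have px: "p x = pu a * pc a b" and qx: "q x = qu a * qc a b"
      and supp: "pu a * qu a > 0 \<Longrightarrow> pc a b * sqrt (s x) > 0 \<Longrightarrow> qc a b > 0"
      using elim(1-3) by (auto simp: a_def b_def)
    have "q x * (pc a b / qc a b) = p x * (qu a / pu a)"
      if "pu a \<noteq> 0" "p x = 0 \<or> s x > 0"
    proof (cases "qu a = 0 \<or> pc a b = 0")
      case False
      then have "pu a > 0" "qu a > 0" "pc a b > 0" using nn that(1) by auto
      moreover from this have "s x > 0" using that px by auto
      ultimately have "qc a b > 0" using supp by simp
      then show ?thesis using that(1) by (simp add: px qx)
    qed (auto simp: px qx)
    then show ?case by (simp add: a_def b_def)
  qed
qed

text \<open>
  The law of \<open>Xu\<close> under \<open>Q\<close> may charge the set where \<open>pu = 0\<close>, which is null under \<open>P\<close>; the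
  hypothesis that \<open>c\<close> vanishes there removes this contribution.
\<close>

lemma marginal_change_of_measure:
  assumes u: "u \<subseteq> {1..k}"
    and P: "input_model P k d X W p" and Q: "input_model Q k d X W q"
    and fP: "density_factors {1..k} u p pu pc" and fQ: "density_factors {1..k} u q qu qc"
    and c: "c \<in> borel_measurable (leb u)" and c0: "\<forall>a\<in>space (leb u). pu a = 0 \<longrightarrow> c a = 0"
  shows "integrable Q (\<lambda>\<omega>. c (restrict (X \<omega>) u)) \<longleftrightarrow>
      integrable P (\<lambda>\<omega>. c (restrict (X \<omega>) u) * (qu (restrict (X \<omega>) u) / pu (restrict (X \<omega>) u)))"
    and "(\<integral>\<omega>. c (restrict (X \<omega>) u) \<partial>Q) =
      (\<integral>\<omega>. c (restrict (X \<omega>) u) * (qu (restrict (X \<omega>) u) / pu (restrict (X \<omega>) u)) \<partial>P)"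
proof -
  have [measurable]: "pu \<in> borel_measurable (leb u)" "qu \<in> borel_measurable (leb u)"
    and nn: "\<And>a. a \<in> space (leb u) \<Longrightarrow> 0 \<le> pu a" "\<And>a. a \<in> space (leb u) \<Longrightarrow> 0 \<le> qu a"
    using fP fQ unfolding density_factors_def by auto
  note [measurable] = c
  have XP: "distributed P (leb {1..k}) X (\<lambda>x. ennreal (p x))"
    and XQ: "distributed Q (leb {1..k}) X (\<lambda>x. ennreal (q x))"
    using P Q unfolding input_model_def by blast+
  have D: "distributed P (leb u) (\<lambda>\<omega>. restrict (X \<omega>) u) (\<lambda>a. ennreal (pu a))"
    "distributed Q (leb u) (\<lambda>\<omega>. restrict (X \<omega>) u) (\<lambda>a. ennreal (qu a))"
    by (rule distributed_restrict[OF _ u XP fP], simp) (rule distributed_restrict[OF _ u XQ fQ], simp)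
  have eq: "AE a in leb u. qu a * c a = pu a * (c a * (qu a / pu a))"
    using AE_space
  proof eventually_elim
    case (elim a)
    then show ?case using c0 by (cases "pu a = 0") auto
  qed
  have h: "(\<lambda>a. c a * (qu a / pu a)) \<in> borel_measurable (leb u)" by measurable
  note tr = distributed_change_of_measure[OF D nn c h eq]
  show "integrable Q (\<lambda>\<omega>. c (restrict (X \<omega>) u)) \<longleftrightarrow>
      integrable P (\<lambda>\<omega>. c (restrict (X \<omega>) u) * (qu (restrict (X \<omega>) u) / pu (restrict (X \<omega>) u)))"
    by (rule tr(1))
  show "(\<integral>\<omega>. c (restrict (X \<omega>) u) \<partial>Q) =
      (\<integral>\<omega>. c (restrict (X \<omega>) u) * (qu (restrict (X \<omega>) u) / pu (restrict (X \<omega>) u)) \<partial>P)"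
    by (rule tr(2))
qed

text \<open>
  The same change of measure with the conditional weight and the output included. It holds because the
  integrands multiplied by their densities agree at almost every \<open>(x, w)\<close>: either \<open>c\<close> or
  \<open>f (x, w)\<close> vanishes, or the conditional weight cancels.
\<close>

lemma weighted_output_change_of_measure:
  fixes f :: "(nat \<Rightarrow> real) \<times> (nat \<Rightarrow> real) \<Rightarrow> real"
    and X W :: "'w \<Rightarrow> nat \<Rightarrow> real" and u :: "nat set" and k :: nat
  defines "Xu \<equiv> (\<lambda>\<omega>. restrict (X \<omega>) u)"
    and "Xc \<equiv> (\<lambda>\<omega>. restrict (X \<omega>) ({1..k} - u))"
  assumes u: "u \<subseteq> {1..k}"
    and f: "f \<in> borel_measurable (leb {1..k} \<Otimes>\<^sub>M leb {1..d})"
    and P: "input_model P k d X W p" and Q: "input_model Q k d X W q"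
    and W: "distr Q (leb {1..d}) W = distr P (leb {1..d}) W"
    and fP: "density_factors {1..k} u p pu pc" and fQ: "density_factors {1..k} u q qu qc"
    and s: "s \<in> borel_measurable (leb {1..k})"
    and f0: "AE \<omega> in P. s (X \<omega>) \<le> 0 \<longrightarrow> f (X \<omega>, W \<omega>) = 0"
    and adm: "admissible {1..k} u pu pc qu qc m (\<lambda>x. sqrt (s x))"
    and c: "c \<in> borel_measurable (leb u)" and c0: "\<forall>a\<in>space (leb u). pu a = 0 \<longrightarrow> c a = 0"
  shows "integrable Q (\<lambda>\<omega>. c (Xu \<omega>) * (pc (Xu \<omega>) (Xc \<omega>) / qc (Xu \<omega>) (Xc \<omega>)) * f (X \<omega>, W \<omega>)) \<longleftrightarrow>
      integrable P (\<lambda>\<omega>. c (Xu \<omega>) * (qu (Xu \<omega>) / pu (Xu \<omega>)) * f (X \<omega>, W \<omega>))"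
    and "(\<integral>\<omega>. c (Xu \<omega>) * (pc (Xu \<omega>) (Xc \<omega>) / qc (Xu \<omega>) (Xc \<omega>)) * f (X \<omega>, W \<omega>) \<partial>Q) =
      (\<integral>\<omega>. c (Xu \<omega>) * (qu (Xu \<omega>) / pu (Xu \<omega>)) * f (X \<omega>, W \<omega>) \<partial>P)"
proof -
  interpret P: prob_space P by (rule input_modelD(1)[OF P])
  let ?\<nu> = "distr P (leb {1..d}) W"
  interpret N: prob_space ?\<nu>
    by (rule P.prob_space_distr) (rule input_modelD(3)[OF P])
  let ?N = "leb {1..k} \<Otimes>\<^sub>M ?\<nu>"
  let ?T = "\<lambda>\<omega>. (X \<omega>, W \<omega>)"
  have DP: "distributed P ?N ?T (\<lambda>z. ennreal (p (fst z)))"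
    by (rule input_model_joint_density[OF P])
  have DQ: "distributed Q ?N ?T (\<lambda>z. ennreal (q (fst z)))"
    using input_model_joint_density[OF Q] unfolding W .
  have [measurable]: "pu \<in> borel_measurable (leb u)" "qu \<in> borel_measurable (leb u)"
    "(\<lambda>(a, b). pc a b) \<in> borel_measurable (leb u \<Otimes>\<^sub>M leb ({1..k} - u))"
    "(\<lambda>(a, b). qc a b) \<in> borel_measurable (leb u \<Otimes>\<^sub>M leb ({1..k} - u))"
    using fP fQ unfolding density_factors_def by auto
  have [measurable]: "(\<lambda>x. restrict x u) \<in> leb {1..k} \<rightarrow>\<^sub>M leb u"
    "(\<lambda>x. restrict x ({1..k} - u)) \<in> leb {1..k} \<rightarrow>\<^sub>M leb ({1..k} - u)"
    by (intro measurable_restrict_subset; use u in blast)+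
  note [measurable] = c s input_modelD(4)[OF P] input_modelD(4)[OF Q]
  have f'[measurable]: "f \<in> borel_measurable ?N"
    using f by (simp cong: measurable_cong_sets sets_pair_measure_cong)
  have f0': "AE z in ?N. 0 < p (fst z) \<longrightarrow> s (fst z) \<le> 0 \<longrightarrow> f z = 0"
    using f0 by (subst distributed_AE[OF DP, symmetric]) measurable
  have "AE x in distr ?N (leb {1..k}) fst. pu (restrict x u) \<noteq> 0 \<longrightarrow> p x = 0 \<or> s x > 0 \<longrightarrow>
    q x * (pc (restrict x u) (restrict x ({1..k} - u)) / qc (restrict x u) (restrict x ({1..k} - u)))
    = p x * (qu (restrict x u) / pu (restrict x u))"
    unfolding N.distr_pair_fst by (rule conditional_weight_cancels[OF _ u fP fQ s adm]) simp
  then have "AE z in ?N. pu (restrict (fst z) u) \<noteq> 0 \<longrightarrow> p (fst z) = 0 \<or> s (fst z) > 0 \<longrightarrow>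
    q (fst z) * (pc (restrict (fst z) u) (restrict (fst z) ({1..k} - u)) /
      qc (restrict (fst z) u) (restrict (fst z) ({1..k} - u)))
    = p (fst z) * (qu (restrict (fst z) u) / pu (restrict (fst z) u))"
    by (rule AE_distrD[OF measurable_fst])
  then have eq: "AE z in ?N.
    q (fst z) * (c (restrict (fst z) u) * (pc (restrict (fst z) u) (restrict (fst z) ({1..k} - u)) /
      qc (restrict (fst z) u) (restrict (fst z) ({1..k} - u))) * f z)
    = p (fst z) * (c (restrict (fst z) u) * (qu (restrict (fst z) u) / pu (restrict (fst z) u)) * f z)"
    using f0' AE_space
  proof eventually_elim
    case (elim z)
    define a b where "a = restrict (fst z) u" and "b = restrict (fst z) ({1..k} - u)"
    have z: "fst z \<in> space (leb {1..k})"
      using elim(3) by (auto simp: space_pair_measure)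
    have p0: "0 \<le> p (fst z)" by (rule input_modelD(5)[OF P z])
    have "a \<in> space (leb u)" using z u by (auto simp: a_def space_PiM)
    then have ca: "pu a = 0 \<Longrightarrow> c a = 0" using c0 by blast
    consider "pu a = 0" | "pu a \<noteq> 0" "f z = 0" | "pu a \<noteq> 0" "p (fst z) = 0 \<or> s (fst z) > 0"
      using elim(2) p0 by linarith
    then have "q (fst z) * (c a * (pc a b / qc a b) * f z) = p (fst z) * (c a * (qu a / pu a) * f z)"
    proof cases
      case 3
      then have "q (fst z) * (pc a b / qc a b) = p (fst z) * (qu a / pu a)"
        using elim(1) by (simp add: a_def b_def)
      then have "c a * f z * (q (fst z) * (pc a b / qc a b)) = c a * f z * (p (fst z) * (qu a / pu a))"
        by simp
      then show ?thesis by (simp only: mult_ac)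
    qed (simp_all add: ca)
    then show ?case by (simp only: a_def b_def)
  qed
  have nn: "0 \<le> p (fst z)" "0 \<le> q (fst z)" if "z \<in> space ?N" for z
    using that input_modelD(5)[OF P] input_modelD(5)[OF Q] by (auto simp: space_pair_measure)
  have g: "(\<lambda>z. c (restrict (fst z) u) * (pc (restrict (fst z) u) (restrict (fst z) ({1..k} - u)) /
      qc (restrict (fst z) u) (restrict (fst z) ({1..k} - u))) * f z) \<in> borel_measurable ?N"
    and h: "(\<lambda>z. c (restrict (fst z) u) * (qu (restrict (fst z) u) / pu (restrict (fst z) u)) * f z)
      \<in> borel_measurable ?N"
    by measurable
  note tr = distributed_change_of_measure[OF DP DQ nn g h eq, unfolded fst_conv]
  show "integrable Q (\<lambda>\<omega>. c (Xu \<omega>) * (pc (Xu \<omega>) (Xc \<omega>) / qc (Xu \<omega>) (Xc \<omega>)) * f (X \<omega>, W \<omega>)) \<longleftrightarrow>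
      integrable P (\<lambda>\<omega>. c (Xu \<omega>) * (qu (Xu \<omega>) / pu (Xu \<omega>)) * f (X \<omega>, W \<omega>))"
    unfolding Xu_def Xc_def by (rule tr(1))
  show "(\<integral>\<omega>. c (Xu \<omega>) * (pc (Xu \<omega>) (Xc \<omega>) / qc (Xu \<omega>) (Xc \<omega>)) * f (X \<omega>, W \<omega>) \<partial>Q) =
      (\<integral>\<omega>. c (Xu \<omega>) * (qu (Xu \<omega>) / pu (Xu \<omega>)) * f (X \<omega>, W \<omega>) \<partial>P)"
    unfolding Xu_def Xc_def by (rule tr(2))
qed

section \<open>The conditional expectation of the weighted output\<close>

lemma abs_mult_le_sum_squares: "\<bar>x * y\<bar> \<le> x\<^sup>2 + y\<^sup>2" for x y :: real
proof -
  have "2 * \<bar>x * y\<bar> \<le> x\<^sup>2 + y\<^sup>2"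
    using sum_squares_bound[of "\<bar>x\<bar>" "\<bar>y\<bar>"] by (simp add: abs_mult)
  then show ?thesis by linarith
qed

theorem lemma3p1:
  fixes P Q :: "'w measure"
    and k d :: nat and u :: "nat set"
    and X W :: "'w \<Rightarrow> nat \<Rightarrow> real"
    and f :: "(nat \<Rightarrow> real) \<times> (nat \<Rightarrow> real) \<Rightarrow> real"
    and p q pu qu m s :: "(nat \<Rightarrow> real) \<Rightarrow> real"
    and pc qc :: "(nat \<Rightarrow> real) \<Rightarrow> (nat \<Rightarrow> real) \<Rightarrow> real"
  defines "Y \<equiv> (\<lambda>\<omega>. f (X \<omega>, W \<omega>))"
    and "Xu \<equiv> (\<lambda>\<omega>. restrict (X \<omega>) u)"
    and "Xc \<equiv> (\<lambda>\<omega>. restrict (X \<omega>) ({1..k} - u))"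
  defines "Z \<equiv> weighted_output pu pc qu qc Xu Xc Y"
  assumes "u \<noteq> {}" and "u \<subseteq> {1..k}"
    and "f \<in> borel_measurable (leb {1..k} \<Otimes>\<^sub>M leb {1..d})"
    and "input_model P k d X W p" and "input_model Q k d X W q"
    and "distr Q (leb {1..d}) W = distr P (leb {1..d}) W"
    and "integrable P (\<lambda>\<omega>. (Y \<omega>)\<^sup>2)"
    and "density_factors {1..k} u p pu pc" and "density_factors {1..k} u q qu qc"
    and "cond_expect_fun P (leb u) Xu Y m"
    and "\<forall>a\<in>space (leb u). pu a = 0 \<longrightarrow> m a = 0"
    and "cond_expect_fun P (leb {1..k}) X (\<lambda>\<omega>. (Y \<omega>)\<^sup>2) s"
    and "admissible {1..k} u pu pc qu qc m (\<lambda>x. sqrt (s x))"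
  shows "integrable Q Z \<and>
    (AE \<omega> in Q. cond_expect Q (leb u) Xu Z \<omega> = sqrt (pu (Xu \<omega>) / qu (Xu \<omega>)) * m (Xu \<omega>)) \<and>
    integrable P (\<lambda>\<omega>. (m (Xu \<omega>))\<^sup>2) \<and>
    integrable P (\<lambda>\<omega>. (cond_expect P (leb u) Xu Y \<omega>)\<^sup>2) \<and>
    integrable Q (\<lambda>\<omega>. (cond_expect Q (leb u) Xu Z \<omega>)\<^sup>2) \<and>
    integrable Q (\<lambda>\<omega>. Z \<omega> * cond_expect Q (leb u) Xu Z \<omega>) \<and>
    (\<integral>\<omega>. (m (Xu \<omega>))\<^sup>2 \<partial>P) = (\<integral>\<omega>. (cond_expect P (leb u) Xu Y \<omega>)\<^sup>2 \<partial>P) \<and>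
    (\<integral>\<omega>. (cond_expect P (leb u) Xu Y \<omega>)\<^sup>2 \<partial>P) = (\<integral>\<omega>. (cond_expect Q (leb u) Xu Z \<omega>)\<^sup>2 \<partial>Q) \<and>
    (\<integral>\<omega>. (cond_expect Q (leb u) Xu Z \<omega>)\<^sup>2 \<partial>Q) = (\<integral>\<omega>. Z \<omega> * cond_expect Q (leb u) Xu Z \<omega> \<partial>Q)"
  proof -
  note u = \<open>u \<subseteq> {1..k}\<close>
  note f = \<open>f \<in> borel_measurable (leb {1..k} \<Otimes>\<^sub>M leb {1..d})\<close>
  note PM = \<open>input_model P k d X W p\<close> and QM = \<open>input_model Q k d X W q\<close>
  note fP = \<open>density_factors {1..k} u p pu pc\<close> and fQ = \<open>density_factors {1..k} u q qu qc\<close>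
  note sq = \<open>integrable P (\<lambda>\<omega>. (Y \<omega>)\<^sup>2)\<close>
  note mY = \<open>cond_expect_fun P (leb u) Xu Y m\<close>
  note m0 = \<open>\<forall>a\<in>space (leb u). pu a = 0 \<longrightarrow> m a = 0\<close>
  note sY = \<open>cond_expect_fun P (leb {1..k}) X (\<lambda>\<omega>. (Y \<omega>)\<^sup>2) s\<close>
  note adm = \<open>admissible {1..k} u pu pc qu qc m (\<lambda>x. sqrt (s x))\<close>
  note P = input_modelD(1)[OF PM] and Q = input_modelD(1)[OF QM]
  interpret P: prob_space P by (rule P)
  interpret Q: prob_space Q by (rule Q)
  have [measurable]: "pu \<in> borel_measurable (leb u)" "qu \<in> borel_measurable (leb u)"
    and nn: "\<And>a. a \<in> space (leb u) \<Longrightarrow> 0 \<le> pu a" "\<And>a. a \<in> space (leb u) \<Longrightarrow> 0 \<le> qu a"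
    using fP fQ unfolding density_factors_def by auto
  have m[measurable]: "m \<in> borel_measurable (leb u)" and s: "s \<in> borel_measurable (leb {1..k})"
    using mY sY unfolding cond_expect_fun_def by blast+
  note [measurable] = input_modelD(2,3)[OF PM] input_modelD(2,3)[OF QM] f
  have res: "(\<lambda>x. restrict x u) \<in> leb {1..k} \<rightarrow>\<^sub>M leb u"
    by (rule measurable_restrict_subset[OF u])
  have XuP[measurable]: "Xu \<in> P \<rightarrow>\<^sub>M leb u" and XuQ[measurable]: "Xu \<in> Q \<rightarrow>\<^sub>M leb u"
    unfolding Xu_def using res by measurable
  have Y[measurable]: "Y \<in> borel_measurable P"
    unfolding Y_def by measurable
  have Xu_sp: "Xu \<omega> \<in> space (leb u)" if "\<omega> \<in> space P" for \<omega>
    using measurable_space[OF XuP that] .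

  define v where "v a = sqrt (pu a / qu a)" for a
  define r where "r a = qu a / pu a" for a
  have v[measurable]: "v \<in> borel_measurable (leb u)" and r[measurable]: "r \<in> borel_measurable (leb u)"
    unfolding v_def r_def by measurable
  have vr: "(v a)\<^sup>2 * r a = (if pu a = 0 \<or> qu a = 0 then 0 else 1)" "0 \<le> r a" "0 \<le> v a"
    if "a \<in> space (leb u)" for a
    using nn[OF that] by (auto simp: v_def r_def)
  have v0: "v a = 0" if "pu a = 0" for a using that by (simp add: v_def)

  have f0: "AE \<omega> in P. s (X \<omega>) \<le> 0 \<longrightarrow> f (X \<omega>, W \<omega>) = 0"
    using zero_where_cond_expect_square_nonpos[OF P input_modelD(2)[OF PM] Y sq sY]
    by (simp add: Y_def)
  let ?w = "\<lambda>\<omega>. pc (Xu \<omega>) (Xc \<omega>) / qc (Xu \<omega>) (Xc \<omega>)"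
  have weighted: "integrable Q (\<lambda>\<omega>. c (Xu \<omega>) * ?w \<omega> * Y \<omega>) \<longleftrightarrow>
        integrable P (\<lambda>\<omega>. c (Xu \<omega>) * r (Xu \<omega>) * Y \<omega>)"
      "(\<integral>\<omega>. c (Xu \<omega>) * ?w \<omega> * Y \<omega> \<partial>Q) = (\<integral>\<omega>. c (Xu \<omega>) * r (Xu \<omega>) * Y \<omega> \<partial>P)"
    if "c \<in> borel_measurable (leb u)" "\<And>a. a \<in> space (leb u) \<Longrightarrow> pu a = 0 \<Longrightarrow> c a = 0" for c
    unfolding Xu_def Xc_def Y_def r_def
    by (rule weighted_output_change_of_measure[OF u f PM QM _ fP fQ s f0 adm]; use assms that in blast)+
  have marginal: "integrable Q (\<lambda>\<omega>. c (Xu \<omega>)) \<longleftrightarrow> integrable P (\<lambda>\<omega>. c (Xu \<omega>) * r (Xu \<omega>))"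
      "(\<integral>\<omega>. c (Xu \<omega>) \<partial>Q) = (\<integral>\<omega>. c (Xu \<omega>) * r (Xu \<omega>) \<partial>P)"
    if "c \<in> borel_measurable (leb u)" "\<And>a. a \<in> space (leb u) \<Longrightarrow> pu a = 0 \<Longrightarrow> c a = 0" for c
    unfolding Xu_def r_def
    by (rule marginal_change_of_measure[OF u PM QM fP fQ]; use that in blast)+
  note pull_out = cond_expect_fun_pull_out[OF P XuP Y mY]

  \<comment> \<open>Division by zero gives \<open>r a = 0\<close> where \<open>pu a = 0\<close>, so \<open>r\<close> is its own product with the
    indicator of \<open>pu \<noteq> 0\<close>, and \<open>E_P [r(Xu)]\<close> is the \<open>Q\<close>-probability of \<open>pu(Xu) \<noteq> 0\<close>.\<close>
  have "integrable Q (\<lambda>\<omega>. indicator {a. pu a \<noteq> 0} (Xu \<omega>) :: real)"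
    by (rule Q.integrable_const_bound[where B = 1]) auto
  then have "integrable P (\<lambda>\<omega>. indicator {a. pu a \<noteq> 0} (Xu \<omega>) * r (Xu \<omega>))"
    by (subst (asm) marginal) auto
  also have "(\<lambda>\<omega>. indicator {a. pu a \<noteq> 0} (Xu \<omega>) * r (Xu \<omega>)) = (\<lambda>\<omega>. r (Xu \<omega>))"
    by (auto simp: fun_eq_iff r_def indicator_def)
  finally have int_r: "integrable P (\<lambda>\<omega>. r (Xu \<omega>))" .

  have int_vrY: "integrable P (\<lambda>\<omega>. (v (Xu \<omega>) * r (Xu \<omega>)) * Y \<omega>)"
  proof (rule Bochner_Integration.integrable_bound[OF Bochner_Integration.integrable_add[OF int_r sq]])
    show "AE \<omega> in P. norm (v (Xu \<omega>) * r (Xu \<omega>) * Y \<omega>) \<le> norm (r (Xu \<omega>) + (Y \<omega>)\<^sup>2)"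
    proof (rule AE_I2)
      fix \<omega> assume "\<omega> \<in> space P"
      note a = vr[OF Xu_sp[OF this]]
      define t where "t = v (Xu \<omega>) * r (Xu \<omega>)"
      have "t\<^sup>2 = ((v (Xu \<omega>))\<^sup>2 * r (Xu \<omega>)) * r (Xu \<omega>)"
        by (simp add: t_def power2_eq_square)
      also have "\<dots> \<le> r (Xu \<omega>)" using a by auto
      finally have "t\<^sup>2 \<le> r (Xu \<omega>)" .
      moreover have "\<bar>t * Y \<omega>\<bar> \<le> t\<^sup>2 + (Y \<omega>)\<^sup>2"
        by (rule abs_mult_le_sum_squares)
      ultimately show "norm (v (Xu \<omega>) * r (Xu \<omega>) * Y \<omega>) \<le> norm (r (Xu \<omega>) + (Y \<omega>)\<^sup>2)"
        using a unfolding t_def[symmetric] real_norm_def by linarith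
    qed
  qed measurable
  have Z_eq: "Z = (\<lambda>\<omega>. v (Xu \<omega>) * ?w \<omega> * Y \<omega>)"
    by (simp add: Z_def weighted_output_def[abs_def] v_def)
  have int_Z: "integrable Q Z"
    unfolding Z_eq using int_vrY by (subst weighted) (auto simp: v0)
  have int_vm: "integrable Q (\<lambda>\<omega>. v (Xu \<omega>) * m (Xu \<omega>))"
    using pull_out(1)[OF _ int_vrY]
    by (subst marginal[of "\<lambda>a. v a * m a"]) (auto simp: v0 ac_simps)
  have cond_Z: "AE \<omega> in Q. cond_expect Q (leb u) Xu Z \<omega> = v (Xu \<omega>) * m (Xu \<omega>)"
  proof (rule cond_expect_eqI[OF Q XuQ _ int_Z, where g = "\<lambda>a. v a * m a"])
    show "(\<lambda>a. v a * m a) \<in> borel_measurable (leb u)" by measurable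
    show "integrable Q (\<lambda>\<omega>. v (Xu \<omega>) * m (Xu \<omega>))" by (rule int_vm)
    fix B assume [measurable]: "B \<in> sets (leb u)"
    let ?h = "\<lambda>a. indicator B a * v a * r a"
    have int: "integrable P (\<lambda>\<omega>. ?h (Xu \<omega>) * Y \<omega>)"
      by (rule Bochner_Integration.integrable_bound[OF int_vrY]) (auto split: split_indicator)
    have "(\<integral>\<omega>. indicator B (Xu \<omega>) * Z \<omega> \<partial>Q) = (\<integral>\<omega>. (indicator B (Xu \<omega>) * v (Xu \<omega>)) * ?w \<omega> * Y \<omega> \<partial>Q)"
      by (simp add: Z_eq mult.assoc)
    also have "\<dots> = (\<integral>\<omega>. ?h (Xu \<omega>) * Y \<omega> \<partial>P)"
      by (rule weighted(2)[of "\<lambda>a. indicator B a * v a"]) (auto simp: v0)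
    also have "\<dots> = (\<integral>\<omega>. ?h (Xu \<omega>) * m (Xu \<omega>) \<partial>P)"
      by (rule pull_out(2)[OF _ int, symmetric]) measurable
    also have "\<dots> = (\<integral>\<omega>. (indicator B (Xu \<omega>) * (v (Xu \<omega>) * m (Xu \<omega>))) * r (Xu \<omega>) \<partial>P)"
      by (simp only: mult_ac)
    also have "\<dots> = (\<integral>\<omega>. indicator B (Xu \<omega>) * (v (Xu \<omega>) * m (Xu \<omega>)) \<partial>Q)"
      by (rule marginal(2)[of "\<lambda>a. indicator B a * (v a * m a)", symmetric]) (auto simp: v0)
    finally show "(\<integral>\<omega>. indicator B (Xu \<omega>) * Z \<omega> \<partial>Q)
      = (\<integral>\<omega>. indicator B (Xu \<omega>) * (v (Xu \<omega>) * m (Xu \<omega>)) \<partial>Q)" .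
  qed

  note m2 = cond_expect_fun_square_integrable[OF P XuP Y mY sq]
  have int_mY: "integrable P (\<lambda>\<omega>. m (Xu \<omega>) * Y \<omega>)"
  proof (rule Bochner_Integration.integrable_bound[OF Bochner_Integration.integrable_add[OF m2(1) sq]])
    show "AE \<omega> in P. norm (m (Xu \<omega>) * Y \<omega>) \<le> norm ((m (Xu \<omega>))\<^sup>2 + (Y \<omega>)\<^sup>2)"
      using abs_mult_le_sum_squares by simp
  qed measurable
  \<comment> \<open>The second admissibility condition: \<open>v^2 * r\<close> differs from 1 only where \<open>pu\<close> or \<open>qu\<close>
    vanishes, and there \<open>m(Xu)\<close> is zero almost surely.\<close>
  have vrm: "AE \<omega> in P. (v (Xu \<omega>))\<^sup>2 * r (Xu \<omega>) * m (Xu \<omega>) = m (Xu \<omega>)"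
  proof -
    have XP: "distributed P (leb {1..k}) X (\<lambda>x. ennreal (p x))"
      using PM unfolding input_model_def by blast
    have D: "distributed P (leb u) Xu (\<lambda>a. ennreal (pu a))"
      unfolding Xu_def by (rule distributed_restrict[OF _ u XP fP]) simp
    have "AE a in leb u. pu a * m a \<noteq> 0 \<longrightarrow> qu a > 0"
      using adm unfolding admissible_def by blast
    then have "AE a in leb u. 0 < pu a \<longrightarrow> (v a)\<^sup>2 * r a * m a = m a"
      using AE_space
    proof eventually_elim
      case (elim a)
      then show ?case using vr(1)[of a] by auto
    qed
    then show ?thesis
      by (subst distributed_AE[OF D, of "\<lambda>a. (v a)\<^sup>2 * r a * m a = m a"]) auto
  qed

  \<comment> \<open>The choices of \<open>c\<close> that produce \<open>(E_Q [Z | Xu])^2\<close> in the marginal, and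
    \<open>Z * E_Q [Z | Xu]\<close> in the weighted, change of measure.\<close>
  let ?c1 = "\<lambda>a. (v a * m a)\<^sup>2" and ?c2 = "\<lambda>a. (v a)\<^sup>2 * m a"
  have e1: "AE \<omega> in P. ?c1 (Xu \<omega>) * r (Xu \<omega>) = (m (Xu \<omega>))\<^sup>2"
    using vrm by eventually_elim (simp add: power2_eq_square mult_ac)
  have e2: "AE \<omega> in P. ?c2 (Xu \<omega>) * r (Xu \<omega>) * Y \<omega> = m (Xu \<omega>) * Y \<omega>"
    using vrm by eventually_elim (simp add: mult_ac)
  have q1: "integrable Q (\<lambda>\<omega>. ?c1 (Xu \<omega>))" "(\<integral>\<omega>. ?c1 (Xu \<omega>) \<partial>Q) = (\<integral>\<omega>. (m (Xu \<omega>))\<^sup>2 \<partial>P)"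
    using marginal[of ?c1] integrable_cong_AE[OF _ _ e1] integral_cong_AE[OF _ _ e1] m2(1)
    by (simp_all add: v0)
  have q2: "integrable Q (\<lambda>\<omega>. ?c2 (Xu \<omega>) * ?w \<omega> * Y \<omega>)"
    "(\<integral>\<omega>. ?c2 (Xu \<omega>) * ?w \<omega> * Y \<omega> \<partial>Q) = (\<integral>\<omega>. m (Xu \<omega>) * Y \<omega> \<partial>P)"
    using weighted[of ?c2] integrable_cong_AE[OF _ _ e2] integral_cong_AE[OF _ _ e2] int_mY
    by (simp_all add: v0)
  have mm: "(\<integral>\<omega>. m (Xu \<omega>) * Y \<omega> \<partial>P) = (\<integral>\<omega>. (m (Xu \<omega>))\<^sup>2 \<partial>P)"
    using pull_out(2)[OF m int_mY] by (simp add: power2_eq_square)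

  have [measurable]: "Z \<in> borel_measurable Q" using int_Z by auto
  have [measurable]: "cond_expect Q (leb u) Xu Z \<in> borel_measurable Q"
    unfolding cond_expect_def by simp
  have c1: "AE \<omega> in Q. ?c1 (Xu \<omega>) = (cond_expect Q (leb u) Xu Z \<omega>)\<^sup>2"
    using cond_Z by eventually_elim simp
  have c2: "AE \<omega> in Q. ?c2 (Xu \<omega>) * ?w \<omega> * Y \<omega> = Z \<omega> * cond_expect Q (leb u) Xu Z \<omega>"
    using cond_Z by eventually_elim (simp add: Z_eq power2_eq_square)
  have [measurable]: "(\<lambda>\<omega>. ?c2 (Xu \<omega>) * ?w \<omega> * Y \<omega>) \<in> borel_measurable Q"
    using q2(1) by (rule borel_measurable_integrable)
  have C1: "integrable Q (\<lambda>\<omega>. (cond_expect Q (leb u) Xu Z \<omega>)\<^sup>2)"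
    "(\<integral>\<omega>. (cond_expect Q (leb u) Xu Z \<omega>)\<^sup>2 \<partial>Q) = (\<integral>\<omega>. (m (Xu \<omega>))\<^sup>2 \<partial>P)"
    using q1 integrable_cong_AE[OF _ _ c1] integral_cong_AE[OF _ _ c1] by simp_all
  have C2: "integrable Q (\<lambda>\<omega>. Z \<omega> * cond_expect Q (leb u) Xu Z \<omega>)"
    "(\<integral>\<omega>. Z \<omega> * cond_expect Q (leb u) Xu Z \<omega> \<partial>Q) = (\<integral>\<omega>. (m (Xu \<omega>))\<^sup>2 \<partial>P)"
    using q2 mm integrable_cong_AE[OF _ _ c2] integral_cong_AE[OF _ _ c2] by simp_all
  show ?thesis
    using int_Z cond_Z m2 C1 C2 by (simp add: v_def)
qed

end
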